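(* Let $K,L\subseteq[0,1]^2$ be non-empty sets each containing only Kurtz random points. Then the property of a continuous function $f:([0,1]\setminus\mathbb{Q})\times[0,1]\to[0,1]^2$ that "for every $x$ in the domain, $f(x)\in K$ implies $x\in L$" is $\Pi^1_1$-hard.
   Context: A point of $[0,1]^2$ is Kurtz random if it lies in no Lebesgue null effectively closed ($\Pi^0_1$) subset of $[0,1]^2$. The domain $([0,1]\setminus\mathbb{Q})\times[0,1]$ is regarded as a subset of $[0,1]^2$. Continuous functions are coded by elements of Baire space in a standard way; a property $P$ of such functions is $\Pi^1_1$-hard if every $\Pi^1_1$ subset of Baire space reduces to $P$ via a continuous map from Baire space to codes of continuous functions (equivalently, the set of well-founded countably-branching trees reduces to it). *)

theory Defs
  imports "HOL-Analysis.Analysis" "HOL-Library.Nat_Bijection"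
begin

text \<open>Computably enumerable sets of natural numbers, via the Kleene mu-recursive partial
  functions. \<open>rec_eval f xs y\<close> says that \<open>f\<close> converges on the argument list \<open>xs\<close> with value
  \<open>y\<close>. In \<open>PrimRec\<close> the recursion argument comes first, and the step function receives the
  counter, the previous value and the parameters; in \<open>Mu\<close> the searched argument comes first.\<close>

datatype recf =
    Zero
  | Succ
  | Proj nat
  | Comp recf "recf list"
  | PrimRec recf recf
  | Mu recf

inductive rec_eval :: "recf \<Rightarrow> nat list \<Rightarrow> nat \<Rightarrow> bool" where
  Zero: "rec_eval Zero xs 0"
| Succ: "rec_eval Succ (x # xs) (Suc x)"
| Proj: "i < length xs \<Longrightarrow> rec_eval (Proj i) xs (xs ! i)"
| Comp: "list_all2 (\<lambda>g y. rec_eval g xs y) gs ys \<Longrightarrow> rec_eval f ys z \<Longrightarrow>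
    rec_eval (Comp f gs) xs z"
| PrimRec_0: "rec_eval f xs y \<Longrightarrow> rec_eval (PrimRec f g) (0 # xs) y"
| PrimRec_Suc: "rec_eval (PrimRec f g) (n # xs) y \<Longrightarrow> rec_eval g (n # y # xs) z \<Longrightarrow>
    rec_eval (PrimRec f g) (Suc n # xs) z"
| Mu: "rec_eval f (n # xs) 0 \<Longrightarrow> (\<forall>m<n. \<exists>y. rec_eval f (m # xs) (Suc y)) \<Longrightarrow>
    rec_eval (Mu f) xs n"

definition comp_enum :: "nat set \<Rightarrow> bool" where
  "comp_enum W \<longleftrightarrow> (\<exists>f. W = {n. \<exists>y. rec_eval f [n] y})"

text \<open>A standard numbering of the open boxes with rational endpoints. Every rational number occurs
  as some \<open>rat_num n\<close>, and degenerate intervals yield the empty box.\<close>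

definition rat_num :: "nat \<Rightarrow> real" where
  "rat_num n = (case prod_decode n of (a, b) \<Rightarrow> of_int (int_decode a) / of_nat (Suc b))"

definition rat_interval :: "nat \<Rightarrow> real set" where
  "rat_interval n = (case prod_decode n of (a, b) \<Rightarrow> {rat_num a<..<rat_num b})"

definition rat_box :: "nat \<Rightarrow> (real \<times> real) set" where
  "rat_box n = (case prod_decode n of (a, b) \<Rightarrow> rat_interval a \<times> rat_interval b)"

definition unit_square :: "(real \<times> real) set" where
  "unit_square = {0..1} \<times> {0..1}"

definition irrational_strip :: "(real \<times> real) set" where
  "irrational_strip = ({0..1} - \<rat>) \<times> {0..1}"

definition effectively_closed :: "(real \<times> real) set \<Rightarrow> bool" where
  "effectively_closed C \<longleftrightarrow> (\<exists>W. comp_enum W \<and> C = unit_square - (\<Union>n\<in>W. rat_box n))"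

definition kurtz_random :: "real \<times> real \<Rightarrow> bool" where
  "kurtz_random x \<longleftrightarrow>
     x \<in> unit_square \<and> (\<forall>C. effectively_closed C \<and> C \<in> null_sets lborel \<longrightarrow> x \<notin> C)"

text \<open>Baire space is the type \<^typ>\<open>nat \<Rightarrow> nat\<close> with its product topology (\<^typ>\<open>nat\<close> being discrete).
  The boldface pointclasses are used: an analytic set is a projection of a closed subset of the
  square of Baire space, and a \<open>\<Pi>\<^sup>1\<^sub>1\<close> set is the complement of an analytic set.\<close>

type_synonym baire = "nat \<Rightarrow> nat"

definition sigma11 :: "baire set \<Rightarrow> bool" where
  "sigma11 A \<longleftrightarrow> (\<exists>F :: (baire \<times> baire) set. closed F \<and> A = fst ` F)"

definition pi11 :: "baire set \<Rightarrow> bool" where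
  "pi11 A \<longleftrightarrow> sigma11 (- A)"

text \<open>\<open>codes D E p f\<close>: the point \<open>p\<close> of Baire space is a code of the continuous function \<open>f\<close> from
  \<open>D\<close> to \<open>E\<close>. As usual for second countable spaces, \<open>p\<close> enumerates pairs of (indices of) basic open
  sets in such a way that the preimage of each basic open set \<open>V\<close> is the union of those basic open
  sets (relative to \<open>D\<close>) that are listed together with \<open>V\<close>. Functions are normalised outside \<open>D\<close>
  by the use of \<^const>\<open>PiE\<close>, so that a code determines its function.\<close>

definition codes ::
    "(real \<times> real) set \<Rightarrow> (real \<times> real) set \<Rightarrow> baire \<Rightarrow> (real \<times> real \<Rightarrow> real \<times> real) \<Rightarrow> bool" where
  "codes D E p f \<longleftrightarrow>
     f \<in> D \<rightarrow>\<^sub>E E \<and> continuous_on D f \<and>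
     (\<forall>j. {x \<in> D. f x \<in> rat_box j} = D \<inter> (\<Union>i \<in> {i. prod_encode (i, j) \<in> range p}. rat_box i))"

definition pi11_hard ::
    "(real \<times> real) set \<Rightarrow> (real \<times> real) set \<Rightarrow> ((real \<times> real \<Rightarrow> real \<times> real) \<Rightarrow> bool) \<Rightarrow> bool" where
  "pi11_hard D E P \<longleftrightarrow>
     (\<forall>A. pi11 A \<longrightarrow>
       (\<exists>\<phi> :: baire \<Rightarrow> baire. continuous_on UNIV \<phi> \<and>
          (\<forall>z. \<exists>f. codes D E (\<phi> z) f \<and> (z \<in> A \<longleftrightarrow> P f))))"

text \<open>The coding is adequate: the boxes form a base, a code determines its function, and
  every continuous function has a code.\<close>

lemma rat_num_surj:
  assumes "q \<in> \<rat>"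
  obtains n where "rat_num n = q"
proof -
  obtain a b where ab: "b > 0" "q = of_int a / of_int b"
    using assms by (metis Rats_cases')
  have "rat_num (prod_encode (int_encode a, nat b - 1)) = q"
    using ab by (simp add: rat_num_def)
  then show ?thesis by (rule that)
qed

lemma rat_interval_base:
  assumes "open U" "x \<in> U"
  obtains n where "x \<in> rat_interval n" "rat_interval n \<subseteq> U"
proof -
  obtain e where e: "e > 0" "\<And>y. dist y x < e \<Longrightarrow> y \<in> U"
    using assms by (meson open_dist)
  obtain a where a: "a \<in> \<rat>" "x - e < a" "a < x" using Rats_dense_in_real[of "x - e" x] e by auto
  obtain b where b: "b \<in> \<rat>" "x < b" "b < x + e" using Rats_dense_in_real[of x "x + e"] e by auto
  obtain m where m: "rat_num m = a" using a rat_num_surj by blast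
  obtain n where n: "rat_num n = b" using b rat_num_surj by blast
  have eq: "rat_interval (prod_encode (m, n)) = {a<..<b}" by (simp add: rat_interval_def m n)
  show ?thesis
  proof (rule that[of "prod_encode (m, n)"])
    show "x \<in> rat_interval (prod_encode (m, n))" using eq a b by simp
    show "rat_interval (prod_encode (m, n)) \<subseteq> U"
      unfolding eq using a b by (auto intro!: e(2) simp: dist_real_def)
  qed
qed

lemma rat_box_base:
  assumes "open U" "x \<in> U"
  obtains n where "x \<in> rat_box n" "rat_box n \<subseteq> U"
proof -
  obtain A B where AB: "open A" "open B" "x \<in> A \<times> B" "A \<times> B \<subseteq> U"
    using assms by (rule open_prod_elim)
  obtain m where m: "fst x \<in> rat_interval m" "rat_interval m \<subseteq> A"
    using AB rat_interval_base[of A "fst x"] by (auto simp: mem_Times_iff)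
  obtain n where n: "snd x \<in> rat_interval n" "rat_interval n \<subseteq> B"
    using AB rat_interval_base[of B "snd x"] by (auto simp: mem_Times_iff)
  show ?thesis
    by (rule that[of "prod_encode (m, n)"]) (use m n AB in \<open>auto simp: rat_box_def mem_Times_iff\<close>)
qed

lemma open_rat_box: "open (rat_box n)"
  by (auto simp: rat_box_def rat_interval_def open_Times split: prod.split)

lemma codes_unique:
  assumes "codes D E p f" "codes D E p g"
  shows "f = g"
proof (rule PiE_ext)
  show "f \<in> D \<rightarrow>\<^sub>E E" "g \<in> D \<rightarrow>\<^sub>E E" using assms by (auto simp: codes_def)
  fix x assume x: "x \<in> D"
  have iff: "f x \<in> rat_box j \<longleftrightarrow> g x \<in> rat_box j" for j
  proof -
    have "{x \<in> D. f x \<in> rat_box j} = {x \<in> D. g x \<in> rat_box j}"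
      using assms by (simp add: codes_def)
    then show ?thesis using x by blast
  qed
  show "f x = g x"
  proof (rule ccontr)
    assume "f x \<noteq> g x"
    then obtain U where U: "open U" "f x \<in> U" "g x \<notin> U" by (meson t1_space)
    then show False using iff by (meson rat_box_base subsetD)
  qed
qed

lemma codes_exists:
  assumes f: "f \<in> D \<rightarrow>\<^sub>E E" and cont: "continuous_on D f"
  shows "\<exists>p. codes D E p f"
proof -
  define S where "S = {(i, j). \<forall>x \<in> D \<inter> rat_box i. f x \<in> rat_box j}"
  have "rat_box (prod_encode (prod_encode (0, 0), 0)) = {}"
    by (simp add: rat_box_def rat_interval_def)
  then have "S \<noteq> {}" by (auto simp: S_def)
  define p where "p = from_nat_into (prod_encode ` S)"
  have "range p = prod_encode ` S"
    using \<open>S \<noteq> {}\<close> unfolding p_def by (intro range_from_nat_into) auto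
  then have mem: "prod_encode (i, j) \<in> range p \<longleftrightarrow> (i, j) \<in> S" for i j
    by (auto simp: image_iff)
  have "\<exists>i. (i, j) \<in> S \<and> x \<in> rat_box i" if x: "x \<in> D" "f x \<in> rat_box j" for x j
  proof -
    obtain U where U: "open U" "U \<inter> D = f -` rat_box j \<inter> D"
      using cont open_rat_box[of j] by (metis continuous_on_open_invariant)
    then have "x \<in> U" using x by blast
    then obtain i where "x \<in> rat_box i" "rat_box i \<subseteq> U" using U rat_box_base by blast
    then show ?thesis using U by (auto simp: S_def)
  qed
  then have "codes D E p f"
    using f cont unfolding codes_def mem by (auto simp: S_def)
  then show ?thesis by blast
qed

end

theory Submission
  imports Defs
begin

text \<open>Let the complement of \<open>A\<close> be the projection of a closed set \<open>F\<close>, let \<open>h\<close> map the irrationals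
  continuously onto Baire space by continued fractions, and fix \<open>k \<in> K\<close>. Put \<open>f\<^sub>z(x, y) = k\<close> if
  \<open>(z, h x) \<in> F\<close>; otherwise let \<open>n\<close> be the length of the shortest prefixes of \<open>z\<close> and \<open>h x\<close> that
  exclude membership in \<open>F\<close>, and replace the first coordinate of \<open>k\<close> by a rational number at
  distance at most \<open>1/(n+1)\<close>. This function is continuous in \<open>z\<close> and \<open>(x, y)\<close> jointly, and its
  values other than \<open>k\<close> are not Kurtz random, as they lie on a vertical line with a rational
  abscissa. If \<open>z \<in> A\<close>, then \<open>f\<^sub>z\<close> avoids \<open>K\<close>. If \<open>z \<notin> A\<close>, then some \<open>(x, 0)\<close> is mapped to \<open>k\<close>, and
  \<open>(x, 0)\<close> lies on the bottom edge of the square, hence outside \<open>L\<close>.\<close>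

section \<open>Points that are not Kurtz random\<close>

text \<open>Needed to show divergence: once a test is known to yield 1, it cannot also yield 0, so a
  search for 0 never halts.\<close>

lemma rec_eval_deterministic:
  assumes "rec_eval f xs y" "rec_eval f xs z"
  shows "y = z"
  using assms
proof (induction arbitrary: z rule: rec_eval.induct)
  case (Comp xs gs ys f v)
  from Comp.prems obtain ys' where ys': "list_all2 (\<lambda>g y. rec_eval g xs y) gs ys'"
    "rec_eval f ys' z"
    by (cases rule: rec_eval.cases) auto
  have "ys = ys'"
  proof (rule nth_equalityI)
    show "length ys = length ys'"
      using Comp.IH(1) ys'(1) by (auto dest!: list_all2_lengthD)
    show "ys ! i = ys' ! i" if "i < length ys" for i
      using Comp.IH(1) ys'(1) that by (auto simp: list_all2_conv_all_nth)
  qed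
  with Comp.IH(2) ys'(2) show ?case by blast
next
  case (Mu f n xs)
  from Mu.prems have z: "rec_eval f (z # xs) 0" "\<forall>m<z. \<exists>y. rec_eval f (m # xs) (Suc y)"
    by (cases rule: rec_eval.cases; auto)+
  show ?case
    using Mu.IH z by (metis nat.distinct(1) nat_neq_iff)
next
  case (PrimRec_Suc f g n xs y v)
  from PrimRec_Suc.prems show ?case
    by (cases rule: rec_eval.cases) (use PrimRec_Suc.IH in blast)
next
  case (PrimRec_0 f xs y g)
  from PrimRec_0.prems show ?case
    by (cases rule: rec_eval.cases) (use PrimRec_0.IH in blast)
qed (erule rec_eval.cases; simp)+

text \<open>Shifting \<open>S\<close> down by one lowers the bound: primitive recursion decides 0
  itself and passes the predecessor of any other number to the program for the shifted set, which
  ignores the previous value. Membership is coded by 0, the value at which \<open>Mu\<close>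
  stops.\<close>

lemma finite_set_characteristic_recf:
  "S \<subseteq> {..<N} \<Longrightarrow> \<exists>f. \<forall>n xs. rec_eval f (n # xs) (if n \<in> S then 0 else 1)"
proof (induction N arbitrary: S)
  case 0
  have "rec_eval (Comp Succ [Zero]) xs (Suc 0)" for xs
    by (rule rec_eval.Comp[where ys = "[0]"]) (auto intro: rec_eval.intros)
  with 0 show ?case by (intro exI[of _ "Comp Succ [Zero]"]) auto
next
  case (Suc N)
  have "{m. Suc m \<in> S} \<subseteq> {..<N}" using Suc.prems by auto
  from Suc.IH[OF this] obtain f
    where f: "\<And>n xs. rec_eval f (n # xs) (if Suc n \<in> S then 0 else 1)" by auto
  define c where "c = (if 0 \<in> S then Zero else Comp Succ [Zero])"
  have c: "rec_eval c xs (if 0 \<in> S then 0 else 1)" for xs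
    unfolding c_def by (auto intro!: rec_eval.Zero rec_eval.Comp[where ys = "[0]"] rec_eval.Succ)
  have "rec_eval (PrimRec c f) (n # xs) (if n \<in> S then 0 else 1)" for n xs
  proof (induction n)
    case 0
    then show ?case by (rule rec_eval.PrimRec_0[OF c])
  next
    case (Suc n)
    then show ?case by (rule rec_eval.PrimRec_Suc) (rule f)
  qed
  then show ?case by blast
qed

text \<open>\<open>W\<close> is the domain of a search whose test ignores the searched number: it
  halts at once on members of \<open>W\<close> and never on other inputs.\<close>

lemma finite_imp_comp_enum:
  assumes "finite W"
  shows "comp_enum W"
proof -
  obtain N where "W \<subseteq> {..<N}" using assms by (metis finite_nat_bounded)
  then obtain f where f: "\<And>n xs. rec_eval f (n # xs) (if n \<in> W then 0 else 1)"
    using finite_set_characteristic_recf by blast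
  define g where "g = Mu (Comp f [Proj 1])"
  have g: "rec_eval (Comp f [Proj 1]) [m, n] (if n \<in> W then 0 else 1)" for m n
    by (rule rec_eval.Comp[where ys = "[n]"])
      (use rec_eval.Proj[of 1 "[m, n]"] f in auto)
  have "n \<in> W \<longleftrightarrow> (\<exists>y. rec_eval g [n] y)" for n
  proof
    assume "n \<in> W"
    then show "\<exists>y. rec_eval g [n] y"
      using g[of 0 n] unfolding g_def by (intro exI[of _ 0] rec_eval.Mu) auto
  next
    assume "\<exists>y. rec_eval g [n] y"
    then obtain y where "rec_eval (Comp f [Proj 1]) [y, n] 0"
      unfolding g_def by (auto elim: rec_eval.cases)
    from rec_eval_deterministic[OF g this] show "n \<in> W"
      by (simp split: if_splits)
  qed
  then show ?thesis unfolding comp_enum_def by blast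
qed

lemma rat_box_surj:
  assumes "a \<in> \<rat>" "b \<in> \<rat>" "c \<in> \<rat>" "d \<in> \<rat>"
  obtains n where "rat_box n = {a<..<b} \<times> {c<..<d}"
proof -
  obtain i j k l where "rat_num i = a" "rat_num j = b" "rat_num k = c" "rat_num l = d"
    using assms rat_num_surj by metis
  then have "rat_box (prod_encode (prod_encode (i, j), prod_encode (k, l)))
      = {a<..<b} \<times> {c<..<d}"
    by (simp add: rat_box_def rat_interval_def)
  then show ?thesis by (rule that)
qed

text \<open>The vertical segment through \<open>a\<close> is null, and as \<open>a\<close> is
  rational, removing two rational boxes from the square leaves exactly this segment.\<close>

lemma not_kurtz_random_rational_fst:
  assumes "a \<in> \<rat>"
  shows "\<not> kurtz_random (a, y)"
proof
  assume kr: "kurtz_random (a, y)"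
  then have a: "a \<in> {0..1}" and y: "y \<in> {0..1}"
    by (auto simp: kurtz_random_def unit_square_def)
  \<comment> \<open>The outer bounds -1 and 2 overshoot the unit square, so that the open boxes also
    cover its edges.\<close>
  obtain m where m: "rat_box m = {-1<..<a} \<times> {-1<..<2}"
    using rat_box_surj[of "-1" a "-1" 2] assms by auto
  obtain n where n: "rat_box n = {a<..<2} \<times> {-1<..<2}"
    using rat_box_surj[of a 2 "-1" 2] assms by auto
  have eq: "unit_square - (\<Union>i\<in>{m, n}. rat_box i) = {a} \<times> {0..1}"
    using a by (auto simp: m n unit_square_def)
  have "effectively_closed ({a} \<times> {0..1})"
    unfolding effectively_closed_def eq[symmetric] by (metis finite.intros finite_imp_comp_enum)
  moreover have "{a} \<times> {0..1} \<in> null_sets (lborel :: (real \<times> real) measure)"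
    unfolding lborel_prod[symmetric] by (intro lborel.times_in_null_sets1) auto
  ultimately show False using kr y by (auto simp: kurtz_random_def)
qed

text \<open>The bottom edge is null and is what a single rational box leaves of the square.\<close>

lemma not_kurtz_random_bottom_edge: "\<not> kurtz_random (x, 0)"
proof
  assume kr: "kurtz_random (x, 0)"
  then have x: "x \<in> {0..1}" by (auto simp: kurtz_random_def unit_square_def)
  obtain n where n: "rat_box n = {-1<..<2} \<times> {0<..<2}"
    using rat_box_surj[of "-1" 2 0 2] by auto
  have eq: "unit_square - (\<Union>i\<in>{n}. rat_box i) = {0..1} \<times> {0}"
    by (auto simp: n unit_square_def)
  have "effectively_closed ({0..1} \<times> {0})"
    unfolding effectively_closed_def eq[symmetric] by (metis finite.intros finite_imp_comp_enum)
  moreover have "{0..1} \<times> {0} \<in> null_sets (lborel :: (real \<times> real) measure)"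
    unfolding lborel_prod[symmetric] by (intro lborel.times_in_null_sets2) auto
  ultimately show False using kr x by (auto simp: kurtz_random_def)
qed

section \<open>Baire space\<close>

definition cylinder :: "nat \<Rightarrow> baire \<Rightarrow> baire set" where
  "cylinder s z = {z'. \<forall>n<s. z' n = z n}"

lemma self_in_cylinder [simp]: "z \<in> cylinder s z"
  by (simp add: cylinder_def)

lemma cylinder_antimono: "s \<le> t \<Longrightarrow> cylinder t z \<subseteq> cylinder s z"
  by (auto simp: cylinder_def)

lemma cylinder_eq: "z' \<in> cylinder s z \<Longrightarrow> t \<le> s \<Longrightarrow> cylinder t z' = cylinder t z"
  by (auto simp: cylinder_def)

lemma open_cylinder: "open (cylinder s z)"
proof -
  have "cylinder s z = (\<Inter>n<s. (\<lambda>z'. z' n) -` {z n})"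
    by (auto simp: cylinder_def)
  moreover have "open ((\<lambda>z'::baire. z' n) -` {z n})" for n
    by (intro open_vimage continuous_on_product_coordinates open_discrete)
  ultimately show ?thesis by auto
qed

text \<open>A basic open set of the product restricts only finitely many coordinates; any bound on
  their indices serves as prefix length.\<close>

lemma cylinder_base:
  assumes "open U" "z \<in> U"
  obtains s where "cylinder s z \<subseteq> U"
proof -
  have "openin (product_topology (\<lambda>_. euclidean) UNIV) U"
    using assms(1) by (simp add: open_fun_def)
  from product_topology_open_contains_basis[OF this assms(2)]
  obtain X where X: "z \<in> (\<Pi>\<^sub>E i\<in>UNIV. X i)" "finite {i. X i \<noteq> (UNIV :: nat set)}"
    "(\<Pi>\<^sub>E i\<in>UNIV. X i) \<subseteq> U"
    by auto
  obtain s where s: "{i. X i \<noteq> UNIV} \<subseteq> {..<s}" using X(2) finite_nat_bounded by blast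
  have "z' i \<in> X i" if "z' \<in> cylinder s z" for z' i
    using that X(1) s by (cases "X i = UNIV") (auto simp: cylinder_def PiE_iff subset_iff)
  then have "cylinder s z \<subseteq> U" using X(3) by (auto simp: PiE_iff)
  then show ?thesis by (rule that)
qed

section \<open>Prefix lengths that separate a point from a closed set\<close>

text \<open>Meaningful only for \<open>u\<close> outside a closed \<open>F\<close>; for
  \<open>u\<close> in \<open>F\<close> no level qualifies and the \<open>LEAST\<close> is
  unspecified.\<close>

definition exit_level :: "(baire \<times> baire) set \<Rightarrow> baire \<times> baire \<Rightarrow> nat" where
  "exit_level F u = (LEAST s. (cylinder s (fst u) \<times> cylinder s (snd u)) \<inter> F = {})"

lemma exit_level:
  assumes "closed F" "u \<notin> F"
  shows "(cylinder (exit_level F u) (fst u) \<times> cylinder (exit_level F u) (snd u)) \<inter> F = {}"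
proof -
  obtain U V where UV: "open U" "open V" "u \<in> U \<times> V" "U \<times> V \<subseteq> - F"
    using assms open_prod_elim[of "- F" u] by (metis ComplI open_Compl)
  obtain s where s: "cylinder s (fst u) \<subseteq> U" using UV cylinder_base by (metis mem_Times_iff)
  obtain t where t: "cylinder t (snd u) \<subseteq> V" using UV cylinder_base by (metis mem_Times_iff)
  have "cylinder (max s t) (fst u) \<times> cylinder (max s t) (snd u) \<subseteq> U \<times> V"
    using s t cylinder_antimono[of s "max s t"] cylinder_antimono[of t "max s t"] by fastforce
  then have "(cylinder (max s t) (fst u) \<times> cylinder (max s t) (snd u)) \<inter> F = {}"
    using UV(4) by blast
  then show ?thesis unfolding exit_level_def by (rule LeastI)
qed

text \<open>Otherwise \<open>u\<close> would share with \<open>v\<close> the prefixes that already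
  exclude membership in \<open>F\<close>. Hence exit levels tend to infinity on approach to
  \<open>F\<close>.\<close>

lemma exit_level_gt:
  assumes "closed F" "u \<in> F" "v \<notin> F" "v \<in> cylinder s (fst u) \<times> cylinder s (snd u)"
  shows "s < exit_level F v"
proof (rule ccontr)
  assume "\<not> s < exit_level F v"
  then have "u \<in> cylinder (exit_level F v) (fst v) \<times> cylinder (exit_level F v) (snd v)"
    using assms(4) by (auto simp: cylinder_def mem_Times_iff)
  with exit_level[OF assms(1,3)] assms(2) show False by blast
qed

text \<open>Up to the exit level of \<open>u\<close> the cylinders around \<open>u\<close> and
  \<open>v\<close> coincide, so the two minima are taken over the same conditions.\<close>

lemma exit_level_locally_constant:
  assumes "closed F" "u \<notin> F"
    and v: "v \<in> cylinder (exit_level F u) (fst u) \<times> cylinder (exit_level F u) (snd u)"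
  shows "v \<notin> F" and "exit_level F v = exit_level F u"
proof -
  show "v \<notin> F" using exit_level[OF assms(1,2)] v by blast
  have eq: "cylinder s (fst v) \<times> cylinder s (snd v) = cylinder s (fst u) \<times> cylinder s (snd u)"
    if "s \<le> exit_level F u" for s
    using v that by (metis cylinder_eq mem_Times_iff)
  have le: "exit_level F v \<le> exit_level F u"
    unfolding exit_level_def[of F v]
    by (rule Least_le) (use eq exit_level[OF assms(1,2)] in simp)
  have "exit_level F u \<le> exit_level F v"
    unfolding exit_level_def[of F u]
    by (rule Least_le) (use eq[OF le] exit_level[OF assms(1) \<open>v \<notin> F\<close>] in simp)
  with le show "exit_level F v = exit_level F u" by simp
qed

text \<open>Off \<open>F\<close> the function is locally constant; near a point of \<open>F\<close>
  the exit levels are large, so the values are \<open>l\<close> or late terms of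
  \<open>a\<close>.\<close>

lemma continuous_exit_level_limit:
  fixes a :: "nat \<Rightarrow> 'a::metric_space"
  assumes F: "closed F" and a: "a \<longlonglongrightarrow> l"
  shows "continuous_on UNIV (\<lambda>u. if u \<in> F then l else a (exit_level F u))"
  unfolding continuous_on_topological
proof (intro ballI allI impI)
  fix u B
  assume "open B" and uB: "(if u \<in> F then l else a (exit_level F u)) \<in> B"
  have "\<exists>s. \<forall>v \<in> cylinder s (fst u) \<times> cylinder s (snd u).
      (if v \<in> F then l else a (exit_level F v)) \<in> B"
  proof (cases "u \<in> F")
    case True
    then obtain s where s: "\<And>n. n \<ge> s \<Longrightarrow> a n \<in> B"
      using a uB \<open>open B\<close> unfolding lim_explicit by auto
    show ?thesis
      using s uB True exit_level_gt[OF F True] by (intro exI[of _ s]) (auto simp: less_imp_le)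
  next
    case False
    show ?thesis
    proof (intro exI ballI)
      fix v
      assume "v \<in> cylinder (exit_level F u) (fst u) \<times> cylinder (exit_level F u) (snd u)"
      note v = exit_level_locally_constant[OF F False this]
      show "(if v \<in> F then l else a (exit_level F v)) \<in> B"
        unfolding v(2) using uB False v(1) by simp
    qed
  qed
  then obtain s where "\<forall>v \<in> cylinder s (fst u) \<times> cylinder s (snd u).
      (if v \<in> F then l else a (exit_level F v)) \<in> B" ..
  then show "\<exists>A. open A \<and> u \<in> A \<and>
      (\<forall>v\<in>UNIV. v \<in> A \<longrightarrow> (if v \<in> F then l else a (exit_level F v)) \<in> B)"
    by (intro exI[of _ "cylinder s (fst u) \<times> cylinder s (snd u)"])
      (simp add: open_Times open_cylinder mem_Times_iff)
qed

section \<open>Continuous families of functions have continuous families of codes\<close>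

text \<open>A pair of boxes is listed as soon as a finite prefix of the parameter guarantees the
  inclusion. Each entry of the code then depends on a finite prefix only, which gives continuity of
  \<phi>.\<close>

lemma codes_parametrised:
  fixes G :: "baire \<times> (real \<times> real) \<Rightarrow> real \<times> real"
  assumes cont: "continuous_on (UNIV \<times> D) G"
    and range: "\<And>z x. x \<in> D \<Longrightarrow> G (z, x) \<in> E"
  obtains \<phi> :: "baire \<Rightarrow> baire" where "continuous_on UNIV \<phi>"
    and "\<And>z. codes D E (\<phi> z) (restrict (\<lambda>x. G (z, x)) D)"
proof
  \<comment> \<open>Quantifying over the whole cylinder, not only over \<open>z\<close>, makes the
    test depend on the first \<open>s\<close> values of \<open>z\<close> alone.\<close>
  define S where "S z i j s \<longleftrightarrow> (\<forall>z' \<in> cylinder s z. \<forall>x \<in> D \<inter> rat_box i. G (z', x) \<in> rat_box j)"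
    for z i j s
  \<comment> \<open>Filler for entries whose test fails: an empty box adds nothing to the preimage
    with which it is listed.\<close>
  define empty_box where "empty_box = prod_encode (prod_encode (0, 0), 0 :: nat)"
  have empty_box: "rat_box empty_box = {}"
    by (simp add: empty_box_def rat_box_def rat_interval_def)
  define \<phi> where "\<phi> z n = (case prod_decode n of (e, s) \<Rightarrow> case prod_decode e of (i, j) \<Rightarrow>
    if S z i j s then e else prod_encode (empty_box, 0))" for z n
  show "continuous_on UNIV \<phi>"
  proof (rule continuous_on_coordinatewise_then_product)
    fix n
    obtain e s where es: "prod_decode n = (e, s)" by fastforce
    have const: "\<phi> z' n = \<phi> z n" if "z' \<in> cylinder s z" for z z'
      using cylinder_eq[OF that order_refl] by (auto simp: \<phi>_def es S_def split: prod.split)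
    show "continuous_on UNIV (\<lambda>z. \<phi> z n)"
      unfolding continuous_on_topological
    proof (intro ballI allI impI)
      fix z B
      assume "\<phi> z n \<in> B"
      then show "\<exists>A. open A \<and> z \<in> A \<and> (\<forall>y\<in>UNIV. y \<in> A \<longrightarrow> \<phi> y n \<in> B)"
        using const by (intro exI[of _ "cylinder s z"]) (auto simp: open_cylinder)
    qed
  qed
  fix z
  have mem: "prod_encode (i, j) \<in> range (\<phi> z) \<longleftrightarrow> (\<exists>s. S z i j s) \<or> i = empty_box \<and> j = 0" for i j
  proof
    assume "prod_encode (i, j) \<in> range (\<phi> z)"
    then show "(\<exists>s. S z i j s) \<or> i = empty_box \<and> j = 0"
      by (auto simp: \<phi>_def split: prod.splits if_splits)
  next
    assume "(\<exists>s. S z i j s) \<or> i = empty_box \<and> j = 0"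
    then show "prod_encode (i, j) \<in> range (\<phi> z)"
    proof
      assume "\<exists>s. S z i j s"
      then obtain s where "S z i j s" ..
      then have "\<phi> z (prod_encode (prod_encode (i, j), s)) = prod_encode (i, j)"
        by (simp add: \<phi>_def)
      then show ?thesis by (metis rangeI)
    next
      assume ij: "i = empty_box \<and> j = 0"
      then have "\<phi> z (prod_encode (prod_encode (i, j), 0)) = prod_encode (i, j)"
        by (simp add: \<phi>_def)
      then show ?thesis by (metis rangeI)
    qed
  qed
  have ex: "\<exists>i s. S z i j s \<and> x \<in> rat_box i" if x: "x \<in> D" "G (z, x) \<in> rat_box j" for x j
  proof -
    \<comment> \<open>Joint continuity yields a cylinder of parameters and a box of arguments that
      work together, so the test succeeds at a finite stage.\<close>
    obtain W where W: "open W" "W \<inter> UNIV \<times> D = G -` rat_box j \<inter> UNIV \<times> D"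
      using cont open_rat_box[of j] by (metis continuous_on_open_invariant)
    then have "(z, x) \<in> W" using x by blast
    then obtain U V where UV: "open U" "open V" "(z, x) \<in> U \<times> V" "U \<times> V \<subseteq> W"
      using W(1) open_prod_elim by metis
    obtain s where s: "cylinder s z \<subseteq> U" using UV cylinder_base by blast
    obtain i where i: "x \<in> rat_box i" "rat_box i \<subseteq> V" using UV rat_box_base by blast
    have "G (z', x') \<in> rat_box j" if "z' \<in> cylinder s z" "x' \<in> D \<inter> rat_box i" for z' x'
    proof -
      have "(z', x') \<in> W \<inter> UNIV \<times> D" using that s i UV(4) by blast
      then show ?thesis unfolding W(2) by blast
    qed
    then have "S z i j s" unfolding S_def by blast
    with i show ?thesis by blast
  qed
  have "continuous_on D (\<lambda>x. G (z, x))"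
    by (rule continuous_on_compose2[OF cont]) (auto intro!: continuous_intros)
  then have "continuous_on D (restrict (\<lambda>x. G (z, x)) D)"
    by (simp cong: continuous_on_cong)
  moreover have "{x \<in> D. restrict (\<lambda>x. G (z, x)) D x \<in> rat_box j}
      = D \<inter> (\<Union>i \<in> {i. prod_encode (i, j) \<in> range (\<phi> z)}. rat_box i)" for j
  proof (intro set_eqI iffI)
    fix x
    assume "x \<in> {x \<in> D. restrict (\<lambda>x. G (z, x)) D x \<in> rat_box j}"
    then have x: "x \<in> D" "G (z, x) \<in> rat_box j" by auto
    from ex[OF this] obtain i s where "S z i j s" "x \<in> rat_box i" by blast
    with x(1) show "x \<in> D \<inter> (\<Union>i \<in> {i. prod_encode (i, j) \<in> range (\<phi> z)}. rat_box i)"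
      unfolding mem by blast
  next
    fix x
    assume "x \<in> D \<inter> (\<Union>i \<in> {i. prod_encode (i, j) \<in> range (\<phi> z)}. rat_box i)"
    then obtain i s where "x \<in> D" "x \<in> rat_box i" "S z i j s"
      by (auto simp: mem empty_box)
    then show "x \<in> {x \<in> D. restrict (\<lambda>x. G (z, x)) D x \<in> rat_box j}"
      by (auto simp: S_def)
  qed
  ultimately show "codes D E (\<phi> z) (restrict (\<lambda>x. G (z, x)) D)"
    unfolding codes_def using range by auto
qed

section \<open>Continued fractions\<close>

definition gauss_map :: "real \<Rightarrow> real" where
  "gauss_map t = frac (1 / t)"

text \<open>Continued fraction digits are shifted by one, so that every sequence of natural numbers
  occurs.\<close>

definition cf_digits :: "real \<Rightarrow> baire" where
  "cf_digits t n = nat \<lfloor>1 / (gauss_map ^^ n) t\<rfloor> - 1"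

lemma inverse_irrational: "t \<notin> \<rat> \<Longrightarrow> 1 / t \<notin> \<rat>" for t :: real
  using Rats_divide[of 1 "1 / t"] by auto

lemma gauss_map_irrational: "t \<notin> \<rat> \<Longrightarrow> gauss_map t \<notin> \<rat>"
  using Rats_add[of "gauss_map t" "of_int \<lfloor>1 / t\<rfloor>"] inverse_irrational[of t]
  by (auto simp: gauss_map_def frac_def)

lemma gauss_map_pow_irrational: "t \<notin> \<rat> \<Longrightarrow> (gauss_map ^^ n) t \<notin> \<rat>"
  by (induction n) (auto simp: gauss_map_irrational)

lemma tendsto_inverse_irrational: "t \<notin> \<rat> \<Longrightarrow> ((\<lambda>s. 1 / s) \<longlongrightarrow> 1 / t) (at t within S)" for t :: real
  by (intro tendsto_intros) auto

text \<open>\<open>frac\<close> jumps only at integers, and \<open>1 / t\<close> is never an integer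
  for irrational \<open>t\<close>.\<close>

lemma continuous_on_gauss_map: "continuous_on (- \<rat>) gauss_map"
  unfolding continuous_on
proof
  fix t :: real
  assume "t \<in> - \<rat>"
  then have t: "t \<notin> \<rat>" "1 / t \<notin> \<int>"
    using inverse_irrational Ints_subset_Rats by auto
  then have "isCont frac (1 / t)" using continuous_frac by blast
  then show "(gauss_map \<longlongrightarrow> gauss_map t) (at t within - \<rat>)"
    unfolding gauss_map_def by (rule isCont_tendsto_compose[OF _ tendsto_inverse_irrational[OF t(1)]])
qed

lemma continuous_on_gauss_map_pow: "continuous_on (- \<rat>) (gauss_map ^^ n)"
proof (induction n)
  case (Suc n)
  show ?case
    unfolding funpow.simps
    by (rule continuous_on_compose[OF Suc])
      (rule continuous_on_subset[OF continuous_on_gauss_map],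
        use gauss_map_pow_irrational in auto)
qed (simp add: id_def)

text \<open>Each digit is locally constant on the irrationals, because the floor is taken at a
  non-integer.\<close>

lemma continuous_on_cf_digits: "continuous_on (- \<rat>) cf_digits"
proof (rule continuous_on_coordinatewise_then_product)
  fix n
  show "continuous_on (- \<rat>) (\<lambda>t. cf_digits t n)"
    unfolding continuous_on
  proof
    fix t :: real
    assume t: "t \<in> - \<rat>"
    let ?T = "gauss_map ^^ n"
    have irr: "?T t \<notin> \<rat>" using t gauss_map_pow_irrational by auto
    have "(?T \<longlongrightarrow> ?T t) (at t within - \<rat>)"
      using continuous_on_gauss_map_pow[of n] t by (simp add: continuous_on)
    then have "((\<lambda>s. 1 / ?T s) \<longlongrightarrow> 1 / ?T t) (at t within - \<rat>)"
      using irr by (intro tendsto_intros) auto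
    moreover have "1 / ?T t \<notin> \<int>" using inverse_irrational[OF irr] Ints_subset_Rats by auto
    ultimately have "\<forall>\<^sub>F s in at t within - \<rat>. \<lfloor>1 / ?T s\<rfloor> = \<lfloor>1 / ?T t\<rfloor>"
      by (rule eventually_floor_eq)
    then have "\<forall>\<^sub>F s in at t within - \<rat>. cf_digits s n = cf_digits t n"
      by eventually_elim (simp add: cf_digits_def)
    then show "((\<lambda>s. cf_digits s n) \<longlongrightarrow> cf_digits t n) (at t within - \<rat>)"
      by (rule tendsto_eventually)
  qed
qed

section \<open>Every digit sequence is realised by an irrational number\<close>

text \<open>The values of continued fractions with leading partial quotients \<open>w 0 + 1\<close>,
  ..., \<open>w (n - 1) + 1\<close> and a remainder in [0, 1]; closed intervals are used for the
  sake of compactness.\<close>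

fun cf_interval :: "baire \<Rightarrow> nat \<Rightarrow> real set" where
  "cf_interval w 0 = {0..1}"
| "cf_interval w (Suc n) = (\<lambda>t. 1 / (real (w 0) + 1 + t)) ` cf_interval (w \<circ> Suc) n"

lemma cf_interval_bounds: "cf_interval w n \<subseteq> {0..1}"
proof (induction n arbitrary: w)
  case (Suc n)
  then have "0 \<le> t" if "t \<in> cf_interval (w \<circ> Suc) n" for t using that by fastforce
  then show ?case by (auto simp: divide_le_eq add_nonneg_nonneg)
qed simp

lemma cf_interval_ne: "cf_interval w n \<noteq> {}"
  by (induction n arbitrary: w) auto

lemma compact_cf_interval: "compact (cf_interval w n)"
proof (induction n arbitrary: w)
  case (Suc n)
  have "t \<ge> 0" if "t \<in> cf_interval (w \<circ> Suc) n" for t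
    using that cf_interval_bounds by fastforce
  then have "continuous_on (cf_interval (w \<circ> Suc) n) (\<lambda>t. 1 / (real (w 0) + 1 + t))"
    by (intro continuous_intros) force
  then show ?case using Suc by (auto intro: compact_continuous_image)
qed simp

lemma cf_interval_Suc_subset: "cf_interval w (Suc n) \<subseteq> cf_interval w n"
proof (induction n arbitrary: w)
  case 0
  show ?case using cf_interval_bounds[of w "Suc 0"] by simp
next
  case (Suc n)
  show ?case
    unfolding cf_interval.simps(2)[of w "Suc n"] cf_interval.simps(2)[of w n]
    by (rule image_mono) (rule Suc)
qed

definition cf_points :: "baire \<Rightarrow> real set" where
  "cf_points w = (\<Inter>n. cf_interval w n)"

text \<open>Compactness of the nested sets replaces a convergence proof for continued
  fractions.\<close>

lemma cf_points_ne: "cf_points w \<noteq> {}"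
  unfolding cf_points_def
  using compact_cf_interval cf_interval_ne lift_Suc_antimono_le[of "cf_interval w", OF cf_interval_Suc_subset]
  by (rule compact_nest)

text \<open>The equation determines the tail \<open>t\<close> from \<open>x\<close>, so one and the
  same \<open>t\<close> lies in the intervals of every depth.\<close>

lemma cf_points_unfold:
  assumes "x \<in> cf_points w"
  obtains t where "t \<in> cf_points (w \<circ> Suc)" "0 \<le> t" "x = 1 / (real (w 0) + 1 + t)"
proof -
  define t where "t = 1 / x - (real (w 0) + 1)"
  have t: "t \<in> cf_interval (w \<circ> Suc) n \<and> x = 1 / (real (w 0) + 1 + t)" for n
  proof -
    have "x \<in> cf_interval w (Suc n)" using assms unfolding cf_points_def by blast
    then obtain s where s: "s \<in> cf_interval (w \<circ> Suc) n" "x = 1 / (real (w 0) + 1 + s)" by auto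
    then have "t = s" by (simp add: t_def)
    with s show ?thesis by simp
  qed
  show ?thesis
  proof
    show "t \<in> cf_points (w \<circ> Suc)" "x = 1 / (real (w 0) + 1 + t)" using t by (auto simp: cf_points_def)
    show "0 \<le> t" using t[of 0] by simp
  qed
qed

text \<open>One unfolding gives positivity; positivity of the tail then gives \<open>x < 1\<close>.
  Strictness is what later makes the floor of \<open>1 / x\<close> exact.\<close>

lemma cf_points_bounds:
  assumes "x \<in> cf_points w"
  shows "0 < x" and "x < 1"
proof -
  have pos: "0 < y" if y: "y \<in> cf_points v" for y v
    using y by (rule cf_points_unfold) auto
  show "0 < x" using pos assms .
  from assms obtain t where "t \<in> cf_points (w \<circ> Suc)" "x = 1 / (real (w 0) + 1 + t)"
    by (rule cf_points_unfold)
  with pos show "x < 1" by fastforce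
qed

text \<open>Infinite descent on the denominator: the Gauss map sends \<open>p/q\<close> to a fraction with
  denominator \<open>p\<close>.\<close>

lemma cf_points_irrational:
  assumes "x \<in> cf_points w"
  shows "x \<notin> \<rat>"
proof
  assume "x \<in> \<rat>"
  have no_denominator: "\<not> (q > 0 \<and> x * real q \<in> \<int>)" if "x \<in> cf_points w" for q :: nat and x w
    using that
  proof (induction q arbitrary: x w rule: less_induct)
    case (less q)
    show ?case
    proof
      assume q: "q > 0 \<and> x * real q \<in> \<int>"
      then obtain i where i: "x * real q = of_int i" by (auto elim: Ints_cases)
      have x: "0 < x" "x < 1" using cf_points_bounds[OF less.prems] .
      then have "0 < i" using i q by (metis of_int_0_less_iff mult_pos_pos of_nat_0_less_iff)
      define p where "p = nat i"
      have p: "x * real q = real p" "p > 0" using i \<open>0 < i\<close> by (auto simp: p_def)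
      have "x * real q < real q" using x q by simp
      then have "p < q" using p by simp
      obtain t where t: "t \<in> cf_points (w \<circ> Suc)" "0 \<le> t" "x = 1 / (real (w 0) + 1 + t)"
        using less.prems by (rule cf_points_unfold)
      have "real q = real p * (real (w 0) + 1 + t)"
        using p(1) t(2) unfolding t(3) by (simp add: field_simps)
      then have "t * real p = of_int (int q - int p * (int (w 0) + 1))"
        by (simp add: algebra_simps)
      then have "t * real p \<in> \<int>" by (metis Ints_of_int)
      with less.IH[OF \<open>p < q\<close> t(1)] p(2) show False by blast
    qed
  qed
  obtain a b where "b > 0" "x = of_int a / of_int b"
    using \<open>x \<in> \<rat>\<close> by (metis Rats_cases')
  then have "nat b > 0 \<and> x * real (nat b) \<in> \<int>" by simp
  with no_denominator[OF assms] show False by blast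
qed

text \<open>As the tail lies strictly between 0 and 1, it is the fractional part of
  \<open>1 / x\<close>, so the Gauss map acts as the shift on \<open>w\<close>.\<close>

lemma cf_digits_cf_points:
  assumes "x \<in> cf_points w"
  shows "cf_digits x n = w n"
  using assms
proof (induction n arbitrary: x w)
  case (0 x w)
  then obtain t where t: "t \<in> cf_points (w \<circ> Suc)" "x = 1 / (real (w 0) + 1 + t)"
    by (rule cf_points_unfold)
  have "\<lfloor>1 / x\<rfloor> = int (w 0) + 1"
    using cf_points_bounds[OF t(1)] t(2) by (simp add: floor_eq_iff)
  then show ?case by (simp add: cf_digits_def)
next
  case (Suc n x w)
  then obtain t where t: "t \<in> cf_points (w \<circ> Suc)" "x = 1 / (real (w 0) + 1 + t)"
    by (rule_tac cf_points_unfold)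
  have "\<lfloor>1 / x\<rfloor> = int (w 0) + 1"
    using cf_points_bounds[OF t(1)] t(2) by (simp add: floor_eq_iff)
  then have "gauss_map x = t" using t(2) by (simp add: gauss_map_def frac_def)
  then have "cf_digits x (Suc n) = cf_digits t n"
    by (simp add: cf_digits_def funpow_Suc_right del: funpow.simps)
  with Suc.IH[OF t(1)] show ?case by simp
qed

lemma cf_digits_surj:
  obtains x where "x \<in> {0..1} - \<rat>" "cf_digits x = w"
proof -
  obtain x where x: "x \<in> cf_points w" using cf_points_ne by blast
  show ?thesis
    by (rule that[of x])
      (use cf_points_bounds[OF x] cf_points_irrational[OF x] cf_digits_cf_points[OF x] in auto)
qed

section \<open>The reduction\<close>

text \<open>Rounding \<open>l\<close> down to a multiple of \<open>1 / (n + 1)\<close> stays within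
  the unit interval.\<close>

lemma rational_approximation_unit_interval:
  fixes l :: real
  assumes "l \<in> {0..1}"
  obtains a :: "nat \<Rightarrow> real" where "\<And>n. a n \<in> \<rat> \<inter> {0..1}" "a \<longlonglongrightarrow> l"
proof
  define a where "a n = of_int \<lfloor>l * real (Suc n)\<rfloor> / real (Suc n)" for n
  show "a n \<in> \<rat> \<inter> {0..1}" for n
  proof -
    have "real_of_int \<lfloor>l * real (Suc n)\<rfloor> \<le> l * real (Suc n)" by simp
    also have "\<dots> \<le> real (Suc n)" using assms by (intro mult_left_le_one_le) auto
    finally show ?thesis using assms by (auto simp: a_def divide_simps)
  qed
  have "\<bar>a n - l\<bar> \<le> 1 / real (Suc n)" for n
  proof -
    have "a n - l = (of_int \<lfloor>l * real (Suc n)\<rfloor> - l * real (Suc n)) / real (Suc n)"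
      by (simp add: a_def diff_divide_distrib del: of_nat_Suc)
    also have "\<bar>\<dots>\<bar> \<le> 1 / real (Suc n)"
      unfolding abs_divide by (intro frac_le) (auto simp del: of_nat_Suc, linarith+)
    finally show ?thesis .
  qed
  then have "(\<lambda>n. a n - l) \<longlonglongrightarrow> 0"
    by (intro Lim_null_comparison[OF _ LIMSEQ_Suc[OF lim_1_over_n]]) auto
  then show "a \<longlonglongrightarrow> l" by (rule LIM_zero_cancel)
qed

theorem theorem7p1:
  fixes K L :: "(real \<times> real) set"
  assumes "K \<subseteq> unit_square" and "L \<subseteq> unit_square"
    and "K \<noteq> {}" and "L \<noteq> {}"
    and "\<forall>x\<in>K. kurtz_random x" and "\<forall>x\<in>L. kurtz_random x"
  shows "pi11_hard irrational_strip unit_square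
           (\<lambda>f. \<forall>x\<in>irrational_strip. f x \<in> K \<longrightarrow> x \<in> L)"
  unfolding pi11_hard_def
proof (intro allI impI)
  fix A
  assume "pi11 A"
  then obtain F :: "(baire \<times> baire) set" where F: "closed F" "- A = fst ` F"
    unfolding pi11_def sigma11_def by blast
  obtain k1 k2 where k: "(k1, k2) \<in> K" using assms(3) by auto
  then have k_unit: "k1 \<in> {0..1}" "k2 \<in> {0..1}"
    using assms(1) by (auto simp: unit_square_def)
  obtain a where a: "\<And>n. a n \<in> \<rat> \<inter> {0..1}" "a \<longlonglongrightarrow> k1"
    using k_unit(1) by (rule rational_approximation_unit_interval) blast
  define g where "g u = (if u \<in> F then k1 else a (exit_level F u))" for u
  have g_cont: "continuous_on UNIV g"
    unfolding g_def using F(1) a(2) by (rule continuous_exit_level_limit)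
  \<comment> \<open>The second coordinate of \<open>x\<close> has no influence on the value, so a
    point with given digits can be chosen on the bottom edge.\<close>
  define G where "G = (\<lambda>(z, x :: real \<times> real). (g (z, cf_digits (fst x)), k2))"
  have "continuous_on (UNIV \<times> irrational_strip) (\<lambda>p. cf_digits (fst (snd p)))"
    by (rule continuous_on_compose2[OF continuous_on_cf_digits])
      (auto intro!: continuous_intros simp: irrational_strip_def)
  then have "continuous_on (UNIV \<times> irrational_strip) (\<lambda>p. g (fst p, cf_digits (fst (snd p))))"
    by (intro continuous_on_compose2[OF g_cont] continuous_on_Pair continuous_on_fst
        continuous_on_id) auto
  then have G_cont: "continuous_on (UNIV \<times> irrational_strip) G"
    unfolding G_def case_prod_beta by (intro continuous_intros)
  have G_unit: "G (z, x) \<in> unit_square" for z x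
    using k_unit a(1) by (auto simp: G_def g_def unit_square_def)
  obtain \<phi> :: "baire \<Rightarrow> baire" where \<phi>: "continuous_on UNIV \<phi>"
    "\<And>z. codes irrational_strip unit_square (\<phi> z) (restrict (\<lambda>x. G (z, x)) irrational_strip)"
    using codes_parametrised[OF G_cont G_unit] by blast
  have "z \<in> A \<longleftrightarrow> (\<forall>x\<in>irrational_strip. G (z, x) \<in> K \<longrightarrow> x \<in> L)" for z
  proof
    assume "z \<in> A"
    \<comment> \<open>With no witness \<open>w\<close> at all, \<open>g\<close> takes only the
      rational values \<open>a n\<close>.\<close>
    then have "(z, w) \<notin> F" for w using F(2) by force
    then have "G (z, x) \<notin> K" for x
      using a(1) assms(5) not_kurtz_random_rational_fst by (auto simp: G_def g_def)
    then show "\<forall>x\<in>irrational_strip. G (z, x) \<in> K \<longrightarrow> x \<in> L" by blast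
  next
    assume hit: "\<forall>x\<in>irrational_strip. G (z, x) \<in> K \<longrightarrow> x \<in> L"
    show "z \<in> A"
    proof (rule ccontr)
      assume "z \<notin> A"
      then obtain w where w: "(z, w) \<in> F" using F(2) by force
      obtain x where x: "x \<in> {0..1} - \<rat>" "cf_digits x = w" by (rule cf_digits_surj)
      have "(x, 0) \<in> irrational_strip" using x by (simp add: irrational_strip_def)
      moreover have "G (z, (x, 0)) \<in> K" using w x k by (simp add: G_def g_def)
      ultimately show False using hit assms(6) not_kurtz_random_bottom_edge by blast
    qed
  qed
  then show "\<exists>\<phi> :: baire \<Rightarrow> baire. continuous_on UNIV \<phi> \<and>
      (\<forall>z. \<exists>f. codes irrational_strip unit_square (\<phi> z) f \<and>
        (z \<in> A \<longleftrightarrow> (\<forall>x\<in>irrational_strip. f x \<in> K \<longrightarrow> x \<in> L)))"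
    using \<phi> by (intro exI[of _ \<phi>] conjI allI
        exI[of _ "restrict (\<lambda>x. G (z, x)) irrational_strip" for z]) auto
qed

end
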